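(* Let $G$ be a finite group such that $\alpha(G) = 3/4$. Then there is an integer $n \geq 3$ such that $|G| = 2^n$ and $G \cong D_8 \times (C_2)^{n-3}$.
   Context: An involution of a group $G$ means any element $x \in G$ with $x^2 = 1$; by this convention the identity element counts as an involution. For a finite group $G$, $j(G)$ denotes the number of involutions in $G$ (including the identity), and $\alpha(G) = j(G)/|G|$. $D_8$ denotes the dihedral group of order $8$, $C_2$ the cyclic group of order $2$, and $(C_2)^k$ the direct product of $k$ copies of $C_2$ (trivial if $k=0$). *)

theory Defs
  imports "HOL-Algebra.Algebra"
begin

(* The identity satisfies the condition and is therefore counted. *)
definition involutions :: "('a, 'b) monoid_scheme \<Rightarrow> 'a set" where
  "involutions G = {x \<in> carrier G. x [^]\<^bsub>G\<^esub> (2::nat) = \<one>\<^bsub>G\<^esub>}"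

definition num_involutions :: "('a, 'b) monoid_scheme \<Rightarrow> nat" where
  "num_involutions G = card (involutions G)"

definition involution_ratio :: "('a, 'b) monoid_scheme \<Rightarrow> real" where
  "involution_ratio G = real (num_involutions G) / real (order G)"

(* The semidirect product of C_n by C_2 acting by inversion; it has order 2 * n for n > 0.
   The pair (i, b) stands for the rotation r^i if b is False and for the reflection r^i s
   if b is True, where s r s = r^-1. *)
definition dihedral_group :: "nat \<Rightarrow> (int \<times> bool) monoid" where
  "dihedral_group n =
     \<lparr>carrier = carrier (integer_mod_group n) \<times> UNIV,
      monoid.mult = (\<lambda>(i, b) (j, c). ((if b then i - j else i + j) mod int n, b \<noteq> c)),
      one = (0, False)\<rparr>"

(* Indexed by the order: D_8 is the symmetry group of the square. *)
abbreviation D8 :: "(int \<times> bool) monoid" where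
  "D8 \<equiv> dihedral_group 4"

definition C2_power :: "nat \<Rightarrow> (nat \<Rightarrow> int) monoid" where
  "C2_power k = product_group {..<k} (\<lambda>_. integer_mod_group 2)"

lemma group_dihedral_group: "group (dihedral_group n)"
proof (rule groupI)
  fix x assume "x \<in> carrier (dihedral_group n)"
  then obtain i b where x: "x = (i, b)" and i: "i \<in> carrier (integer_mod_group n)"
    by (auto simp: dihedral_group_def)
  define y where "y = ((if b then i else (- i) mod int n), b)"
  have "y \<in> carrier (dihedral_group n)"
    using i by (auto simp: y_def dihedral_group_def carrier_integer_mod_group)
  moreover have "y \<otimes>\<^bsub>dihedral_group n\<^esub> x = \<one>\<^bsub>dihedral_group n\<^esub>"
    by (auto simp: x y_def dihedral_group_def mod_simps)
  ultimately show "\<exists>y\<in>carrier (dihedral_group n).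
      y \<otimes>\<^bsub>dihedral_group n\<^esub> x = \<one>\<^bsub>dihedral_group n\<^esub>"
    by blast
qed (auto simp: dihedral_group_def carrier_integer_mod_group mod_simps algebra_simps
       split: if_splits)

lemma order_dihedral_group: "n > 0 \<Longrightarrow> order (dihedral_group n) = 2 * n"
  by (simp add: order_def dihedral_group_def carrier_integer_mod_group card_cartesian_product)

lemma group_C2_power: "group (C2_power k)"
  by (simp add: C2_power_def)

lemma order_C2_power: "order (C2_power k) = 2 ^ k"
  by (simp add: order_def C2_power_def carrier_integer_mod_group card_PiE)

end

theory Submission
  imports Defs
begin

text \<open>
  Write \<open>I\<close> for the set of involutions of \<open>G\<close>. For \<open>x \<in> I\<close> the sets \<open>I\<close> and \<open>x I\<close> both have
  \<open>3|G|/4\<close> elements, so they overlap in at least half of \<open>G\<close>. An involution \<open>y\<close> for which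
  \<open>x y\<close> is also an involution commutes with \<open>x\<close>, so at least half of the elements of \<open>G\<close> are
  involutions in the centralizer of \<open>x\<close> (\<open>card_commuting_involutions\<close>). If \<open>x\<close> is not
  central, Lagrange's theorem leaves no slack: the centralizer \<open>A\<close> of \<open>x\<close> has index 2 and consists
  of involutions (\<open>centralizer_noncentral_involution\<close>). Not all involutions are central, since
  otherwise they would form a subgroup of index \<open>4/3\<close> (\<open>noncentral_involution_exists\<close>).

  As \<open>A\<close> accounts for only \<open>|G|/2\<close> involutions, there are \<open>|G|/4\<close> more outside of \<open>A\<close>; let \<open>t\<close> be
  one. They are exactly the products \<open>v t\<close> with \<open>v\<close> in the subgroup \<open>V\<close> of the elements of \<open>A\<close>
  that commute with \<open>t\<close>, hence \<open>V\<close> has index 4. The involutions \<open>x\<close> and \<open>t\<close> do not commute, and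
  \<open>r = x t\<close> has its square in \<open>V\<close>, so \<open>r\<close> and \<open>t\<close> generate a dihedral group of order 8
  which meets \<open>V\<close> in \<open>{1, r\<^sup>2}\<close>. The group \<open>V\<close> is elementary abelian, so \<open>{1, r\<^sup>2}\<close> has a
  complement \<open>W\<close> in it (\<open>exponent_two_complement\<close>). Since \<open>W\<close> commutes with \<open>r\<close> and \<open>t\<close>, a
  comparison of orders shows that \<open>G\<close> is the direct product of the dihedral group and \<open>W\<close>
  (\<open>iso_D8_C2_power\<close>).
\<close>

section \<open>Centralizers, involutions and subgroups of index 2\<close>

definition centralizer :: "('a, 'b) monoid_scheme \<Rightarrow> 'a \<Rightarrow> 'a set" where
  "centralizer G x = {y \<in> carrier G. x \<otimes>\<^bsub>G\<^esub> y = y \<otimes>\<^bsub>G\<^esub> x}"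

lemma (in group) subgroup_centralizer:
  assumes x: "x \<in> carrier G"
  shows "subgroup (centralizer G x) G"
proof (rule subgroupI)
  show "centralizer G x \<noteq> {}"
    using x by (auto simp: centralizer_def)
next
  fix y assume "y \<in> centralizer G x"
  then show "inv y \<in> centralizer G x"
    using x by (auto simp: centralizer_def) (metis inv_closed inv_solve_left inv_solve_right m_assoc m_closed)
next
  fix y z assume "y \<in> centralizer G x" "z \<in> centralizer G x"
  then show "y \<otimes> z \<in> centralizer G x"
    using x by (auto simp: centralizer_def) (metis m_assoc)
qed (auto simp: centralizer_def)

lemma (in group) mem_involutions_iff:
  "x \<in> involutions G \<longleftrightarrow> x \<in> carrier G \<and> x \<otimes> x = \<one>"
  by (auto simp: involutions_def numeral_2_eq_2)

text \<open>
  All three of \<open>x\<close>, \<open>y\<close> and \<open>x y\<close> are their own inverses, so \<open>x y = (x y)\<^sup>-\<^sup>1 = y\<^sup>-\<^sup>1 x\<^sup>-\<^sup>1 = y x\<close>.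
\<close>

lemma (in group) commute_if_involutions:
  assumes "x \<in> involutions G" "y \<in> involutions G" "x \<otimes> y \<in> involutions G"
  shows "x \<otimes> y = y \<otimes> x"
  using assms by (metis inv_mult_group mem_involutions_iff inv_equality)

lemma (in group) mult_involutions:
  assumes "x \<in> involutions G" "y \<in> involutions G" "x \<otimes> y = y \<otimes> x"
  shows "x \<otimes> y \<in> involutions G"
  using assms unfolding mem_involutions_iff by (metis m_assoc m_closed r_one)

lemma (in group) order_le_twice_proper_subgroup:
  assumes fin: "finite (carrier G)" and H: "subgroup H G" and "H \<noteq> carrier G"
  shows "2 * card H \<le> order G"
proof -
  have l: "card (rcosets H) * card H = order G" using lagrange[OF H] .
  have "card H \<noteq> order G"
    using assms unfolding order_def by (metis card_subset_eq subgroup.subset)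
  moreover have "order G > 0" using fin order_gt_0_iff_finite by simp
  ultimately have "card (rcosets H) \<noteq> 0" "card (rcosets H) \<noteq> 1"
    using l by (metis less_irrefl mult_0, metis mult_1)
  then have "2 \<le> card (rcosets H)" by simp
  then show ?thesis using l mult_le_mono1 by metis
qed

text \<open>
  Because \<open>t\<close> lies outside of the subgroup \<open>H\<close> of index 2, the group is the union of \<open>H\<close> and \<open>H t\<close>,
  and right multiplication by the involution \<open>t\<close> exchanges these two cosets.
\<close>

lemma (in group) mult_mem_index_two_subgroup:
  assumes fin: "finite (carrier G)" and H: "subgroup H G" and ind: "2 * card H = order G"
    and t: "t \<in> carrier G - H" and y: "y \<in> carrier G - H" and tt: "t \<otimes> t = \<one>"
  shows "y \<otimes> t \<in> H"
proof -
  have sub: "H \<subseteq> carrier G" using H by (rule subgroup.subset)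
  let ?K = "(\<lambda>h. h \<otimes> t) ` H"
  have "card ?K = card H"
    using sub t by (intro card_image inj_onI) (auto simp: subset_iff)
  moreover have disj: "H \<inter> ?K = {}"
  proof -
    have False if "h \<in> H" "h \<otimes> t \<in> H" for h
    proof -
      have "inv h \<otimes> (h \<otimes> t) \<in> H"
        using that H by (meson subgroup.m_closed subgroup.m_inv_closed)
      then show False using that sub t by (auto simp: m_assoc[symmetric] subset_iff)
    qed
    then show ?thesis by auto
  qed
  ultimately have "card (H \<union> ?K) = card (carrier G)"
    using ind fin sub finite_subset[OF sub fin] by (simp add: card_Un_disjoint order_def)
  then have "H \<union> ?K = carrier G"
    using sub t fin by (intro card_subset_eq) auto
  then obtain h where "h \<in> H" "y = h \<otimes> t" using y by blast
  then show ?thesis using t tt sub by (auto simp: m_assoc subset_iff)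
qed

section \<open>Complements in groups of exponent 2\<close>

text \<open>
  The complement of \<open>U\<close> is the image of an injective homomorphism from a power of \<open>C_2\<close>. That only
  the identity is mapped into \<open>U\<close> says at once that the homomorphism is injective and that its
  image meets \<open>U\<close> trivially. The induction enlarges \<open>U\<close>: for \<open>v\<close> outside of \<open>U\<close>, the subgroup
  \<open>W = U \<union> U v\<close> has twice the size of \<open>U\<close>, and \<open>v\<close> together with a complement of \<open>W\<close>
  generates a complement of \<open>U\<close>.
\<close>

lemma (in group) exponent_two_complement:
  assumes fin: "finite (carrier G)" and sq: "\<And>x. x \<in> carrier G \<Longrightarrow> x \<otimes> x = \<one>"
    and "subgroup U G"
  shows "\<exists>k h. h \<in> hom (C2_power k) G \<and> order G = card U * 2 ^ k \<and>
    (\<forall>f \<in> carrier (C2_power k). h f \<in> U \<longrightarrow> f = \<one>\<^bsub>C2_power k\<^esub>)"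
  using \<open>subgroup U G\<close>
proof (induction "order G - card U" arbitrary: U rule: less_induct)
  case less
  note U = less.prems
  have sub: "U \<subseteq> carrier G" using U by (rule subgroup.subset)
  have comm: "x \<otimes> y = y \<otimes> x" if "x \<in> carrier G" "y \<in> carrier G" for x y
    using that sq by (metis commute_if_involutions mem_involutions_iff m_closed)
  show ?case
  proof (cases "U = carrier G")
    case True
    have "(\<lambda>f. \<one>) \<in> hom (C2_power 0) G" by (auto simp: hom_def)
    then show ?thesis using True by (intro exI[of _ 0] exI[of _ "\<lambda>f. \<one>"])
        (auto simp: C2_power_def order_def)
  next
    case False
    then obtain v where v: "v \<in> carrier G" "v \<notin> U" using sub by blast
    define W where "W = U \<union> (\<lambda>u. u \<otimes> v) ` U"
    have uc: "\<And>u. u \<in> U \<Longrightarrow> u \<in> carrier G" using sub by blast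
    have W: "subgroup W G"
    proof (rule subgroupI)
      show "W \<subseteq> carrier G" using sub v by (auto simp: W_def)
      show "W \<noteq> {}" using U subgroup.one_closed by (fastforce simp: W_def)
      have inv: "inv x = x" if "x \<in> carrier G" for x using sq that inv_equality by simp
      show "inv x \<in> W" if "x \<in> W" for x
        using that \<open>W \<subseteq> carrier G\<close> inv by (metis subsetD)
      show "x \<otimes> y \<in> W" if "x \<in> W" "y \<in> W" for x y
      proof -
        have 1: "u \<otimes> v \<otimes> w = u \<otimes> w \<otimes> v" "u \<otimes> (w \<otimes> v) = u \<otimes> w \<otimes> v" if "u \<in> U" "w \<in> U" for u w
          using that uc v comm[of v w] by (simp_all add: m_assoc)
        have 2: "u \<otimes> v \<otimes> (w \<otimes> v) = u \<otimes> w" if "u \<in> U" "w \<in> U" for u w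
        proof -
          have "u \<otimes> v \<otimes> (w \<otimes> v) = u \<otimes> v \<otimes> w \<otimes> v"
            using that uc v by (simp add: m_assoc)
          also have "\<dots> = u \<otimes> w \<otimes> v \<otimes> v" using 1 that by simp
          finally show ?thesis using that uc v sq by (simp add: m_assoc)
        qed
        show ?thesis using that 1 2 subgroup.m_closed[OF U] by (auto simp: W_def)
      qed
    qed
    have finU: "finite U" using sub fin finite_subset by blast
    have nv: "u \<otimes> v \<notin> U" if "u \<in> U" for u
    proof
      assume "u \<otimes> v \<in> U"
      then have "u \<otimes> (u \<otimes> v) \<in> U" using subgroup.m_closed[OF U that] by simp
      moreover have "u \<otimes> (u \<otimes> v) = v" using uc[OF that] v(1) sq by (simp add: m_assoc[symmetric])
      ultimately show False using v(2) by simp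
    qed
    have "card ((\<lambda>u. u \<otimes> v) ` U) = card U"
      using uc v by (intro card_image inj_onI) auto
    then have cW: "card W = 2 * card U"
      unfolding W_def using nv finU by (subst card_Un_disjoint) auto
    have "card U > 0" using finU subgroup.one_closed[OF U] by (auto simp: card_gt_0_iff)
    moreover have "card W \<le> order G"
      using W fin unfolding order_def by (intro card_mono) (auto dest: subgroup.subset)
    ultimately have "order G - card W < order G - card U" using cW by linarith
    from less.hyps[OF this W] obtain k h where h: "h \<in> hom (C2_power k) G"
      and o: "order G = card W * 2 ^ k"
      and inj: "\<And>f. f \<in> carrier (C2_power k) \<Longrightarrow> h f \<in> W \<Longrightarrow> f = \<one>\<^bsub>C2_power k\<^esub>"
      by blast
    define h' where "h' f = h (restrict f {..<k}) \<otimes> (if f k = 0 then \<one> else v)" for f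
    have mem: "restrict f {..<k} \<in> carrier (C2_power k)" "f k = 0 \<or> f k = 1"
      if f: "f \<in> carrier (C2_power (Suc k))" for f
    proof -
      have "f i \<in> {0..<2}" if "i < Suc k" for i
        using f that by (auto simp: C2_power_def carrier_integer_mod_group PiE_iff)
      note 1 = this
      show "restrict f {..<k} \<in> carrier (C2_power k)"
        using 1 by (auto simp: C2_power_def carrier_integer_mod_group)
      show "f k = 0 \<or> f k = 1" using 1[of k] by auto
    qed
    have hc: "h f \<in> carrier G" if "f \<in> carrier (C2_power k)" for f
      using h that by (auto simp: hom_def)
    have "h' \<in> hom (C2_power (Suc k)) G"
    proof (rule homI)
      fix f assume f: "f \<in> carrier (C2_power (Suc k))"
      show "h' f \<in> carrier G" using hc[OF mem(1)[OF f]] v by (simp add: h'_def)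
      fix g assume g: "g \<in> carrier (C2_power (Suc k))"
      let ?f = "restrict f {..<k}" and ?g = "restrict g {..<k}"
      let ?p = "f \<otimes>\<^bsub>C2_power (Suc k)\<^esub> g"
      have "restrict ?p {..<k} = ?f \<otimes>\<^bsub>C2_power k\<^esub> ?g"
        by (auto simp: C2_power_def fun_eq_iff)
      then have 1: "h (restrict ?p {..<k}) = h ?f \<otimes> h ?g"
        using h mem(1)[OF f] mem(1)[OF g] by (simp add: hom_mult)
      have 2: "?p k = (f k + g k) mod 2" by (simp add: C2_power_def)
      note c = hc[OF mem(1)[OF f]] hc[OF mem(1)[OF g]] v(1)
      have 3: "a \<otimes> v \<otimes> (b \<otimes> v) = a \<otimes> b" if "a \<in> carrier G" "b \<in> carrier G" for a b
        using that v sq by (metis comm m_assoc m_closed r_one)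
      show "h' ?p = h' f \<otimes> h' g"
        using mem(2)[OF f] mem(2)[OF g] c comm[of v "h ?g"] unfolding h'_def 1 2
        by (auto simp: 3) (auto simp: m_assoc)
    qed
    moreover have "f = \<one>\<^bsub>C2_power (Suc k)\<^esub>"
      if f: "f \<in> carrier (C2_power (Suc k))" and hf: "h' f \<in> U" for f
    proof -
      let ?f = "restrict f {..<k}"
      note c = hc[OF mem(1)[OF f]]
      have "h ?f = h' f \<or> h ?f = h' f \<otimes> v"
        using c v sq unfolding h'_def by (auto simp: m_assoc)
      then have "h ?f \<in> W" using hf by (auto simp: W_def)
      then have one: "?f = \<one>\<^bsub>C2_power k\<^esub>" using inj mem(1)[OF f] by blast
      then have "h ?f = \<one>" using h by (simp add: hom_one group_C2_power is_group)
      then have "f k = 0" using hf v by (auto simp: h'_def split: if_splits)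
      then show ?thesis
        using one f by (auto simp: C2_power_def fun_eq_iff PiE_iff extensional_def restrict_def less_Suc_eq)
          metis
    qed
    ultimately show ?thesis
      using o cW by (intro exI[of _ "Suc k"] exI[of _ h']) auto
  qed
qed

section \<open>Recognizing the direct product of a dihedral and an elementary abelian group\<close>

text \<open>
  The relation between \<open>r\<close> and \<open>t\<close> moves \<open>t\<close> past a power of \<open>r\<close> at the price of inverting that
  power, \<open>t r\<^sup>j = r\<^sup>-\<^sup>j t\<close>, which is the multiplication rule of the dihedral group.
\<close>

lemma (in group) dihedral_hom:
  assumes r: "r \<in> carrier G" and t: "t \<in> carrier G" and rn: "r [^] n = \<one>"
    and tt: "t \<otimes> t = \<one>" and trt: "t \<otimes> r \<otimes> t = inv r"
  shows "(\<lambda>(i::int, b). r [^] i \<otimes> (if b then t else \<one>)) \<in> hom (dihedral_group n) G"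
proof -
  have mod: "r [^] (i mod int n) = r [^] i" for i :: int
  proof -
    have "r [^] i = r [^] (int n * (i div int n) + i mod int n)" by simp
    also have "\<dots> = (r [^] int n) [^] (i div int n) \<otimes> r [^] (i mod int n)"
      using r by (simp only: int_pow_mult int_pow_pow)
    finally show ?thesis using r rn by (simp add: int_pow_int)
  qed
  \<comment> \<open>Conjugation by \<open>t\<close> is a homomorphism, so it inverts every power of \<open>r\<close> as soon as it inverts \<open>r\<close>.\<close>
  have conj: "(\<lambda>x. t \<otimes> x \<otimes> t) \<in> hom G G"
  proof (rule homI)
    fix x y assume "x \<in> carrier G" "y \<in> carrier G"
    moreover from this have "t \<otimes> x \<otimes> t \<otimes> (t \<otimes> y \<otimes> t) = t \<otimes> x \<otimes> (t \<otimes> t) \<otimes> y \<otimes> t"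
      using t by (simp only: m_assoc m_closed)
    ultimately show "t \<otimes> (x \<otimes> y) \<otimes> t = t \<otimes> x \<otimes> t \<otimes> (t \<otimes> y \<otimes> t)"
      using t tt by (simp add: m_assoc)
  qed (use t in auto)
  have "t \<otimes> r [^] i \<otimes> t = r [^] (- i)" for i :: int
    using hom_int_pow[OF conj r is_group is_group, of i] trt r by (simp add: int_pow_inv int_pow_neg)
  then have "t \<otimes> r [^] i \<otimes> t \<otimes> t = r [^] (- i) \<otimes> t" for i :: int by simp
  then have swap: "t \<otimes> r [^] i = r [^] (- i) \<otimes> t" for i :: int
    using r t tt by (simp add: m_assoc)
  show ?thesis
  proof (rule homI; clarify)
    fix i j :: int and b c
    have "r [^] i \<otimes> t \<otimes> (r [^] j \<otimes> x) = r [^] (i - j) \<otimes> (t \<otimes> x)" if "x \<in> carrier G" for x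
    proof -
      have "r [^] i \<otimes> t \<otimes> (r [^] j \<otimes> x) = r [^] i \<otimes> (t \<otimes> r [^] j) \<otimes> x"
        using that r t by (simp add: m_assoc)
      also have "\<dots> = r [^] (i + - j) \<otimes> (t \<otimes> x)"
        unfolding swap int_pow_mult[OF r] using that r t by (simp add: m_assoc)
      finally show ?thesis by simp
    qed
    from this[of t] this[of \<one>]
    show "(case (i, b) \<otimes>\<^bsub>dihedral_group n\<^esub> (j, c) of (i, b) \<Rightarrow> r [^] i \<otimes> (if b then t else \<one>)) =
      r [^] i \<otimes> (if b then t else \<one>) \<otimes> (r [^] j \<otimes> (if c then t else \<one>))"
      using r t tt by (auto simp: dihedral_group_def mod int_pow_mult m_assoc)
  qed (use r t in auto)
qed


text \<open>
  The dihedral group generated by \<open>r\<close> and \<open>t\<close> meets \<open>V\<close> only in \<open>{1, r\<^sup>2}\<close>, because its other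
  elements are \<open>r\<close>, \<open>t\<close>, \<open>r t\<close> and their multiples by \<open>r\<^sup>2 \<in> V\<close>. Hence the product map from \<open>D8\<close> and a
  complement of \<open>{1, r\<^sup>2}\<close> in \<open>V\<close> to \<open>G\<close> is injective. An upper bound for the order of \<open>G\<close>
  then suffices to make it surjective.
\<close>

lemma (in group) iso_D8_C2_power:
  assumes fin: "finite (carrier G)" and V: "subgroup V G" and index: "order G \<le> 4 * card V"
    and sq: "\<And>v. v \<in> V \<Longrightarrow> v \<otimes> v = \<one>"
    and r: "r \<in> carrier G" and t: "t \<in> carrier G"
    and tt: "t \<otimes> t = \<one>" and trt: "t \<otimes> r \<otimes> t = inv r"
    and rr: "r \<otimes> r \<in> V" "r \<otimes> r \<noteq> \<one>"
    and notV: "r \<notin> V" "t \<notin> V" "r \<otimes> t \<notin> V"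
    and rV: "\<And>v. v \<in> V \<Longrightarrow> r \<otimes> v = v \<otimes> r" and tV: "\<And>v. v \<in> V \<Longrightarrow> t \<otimes> v = v \<otimes> t"
  shows "\<exists>k. order G = 8 * 2 ^ k \<and> G \<cong> D8 \<times>\<times> C2_power k"
proof -
  have VG: "\<And>v. v \<in> V \<Longrightarrow> v \<in> carrier G" using V subgroup.mem_carrier by metis
  let ?V = "G\<lparr>carrier := V\<rparr>"
  interpret V: group ?V using V by (rule subgroup_imp_group)
  have "subgroup {\<one>, r \<otimes> r} ?V"
  proof (rule V.subgroupI)
    show "inv\<^bsub>?V\<^esub> a \<in> {\<one>, r \<otimes> r}" if "a \<in> {\<one>, r \<otimes> r}" for a
    proof -
      have "inv\<^bsub>?V\<^esub> a = a"
        using that sq rr V by (intro V.inv_equality) (auto intro: subgroup.one_closed)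
      then show ?thesis using that by simp
    qed
  qed (use rr sq[OF rr(1)] r V in \<open>auto intro: subgroup.one_closed\<close>)
  moreover have "finite (carrier ?V)" using VG fin by (auto intro: finite_subset)
  ultimately obtain k h where h: "h \<in> hom (C2_power k) ?V"
    and o: "card V = card {\<one>, r \<otimes> r} * 2 ^ k"
    and inj: "\<And>f. f \<in> carrier (C2_power k) \<Longrightarrow> h f \<in> {\<one>, r \<otimes> r} \<Longrightarrow> f = \<one>\<^bsub>C2_power k\<^esub>"
    using V.exponent_two_complement[of "{\<one>, r \<otimes> r}"] sq by (auto simp: order_def)
  have hV: "h f \<in> V" if "f \<in> carrier (C2_power k)" for f
    using h that by (auto simp: hom_def)
  define \<psi> where "\<psi> = (\<lambda>(i::int, b). r [^] i \<otimes> (if b then t else \<one>))"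
  have "r [^] (4::nat) = (r \<otimes> r) \<otimes> (r \<otimes> r)"
    using r by (simp add: numeral_eq_Suc m_assoc)
  then have \<psi>: "\<psi> \<in> hom D8 G"
    unfolding \<psi>_def using sq[OF rr(1)] by (intro dihedral_hom r t tt trt) simp
  have \<psi>G: "\<psi> p \<in> carrier G" for p
    using r t by (auto simp: \<psi>_def split: prod.split)
  have "r [^] i \<otimes> v = v \<otimes> r [^] i" if v: "v \<in> V" for v and i :: int
  proof -
    have "subgroup (centralizer G v) G" using VG[OF v] by (rule subgroup_centralizer)
    moreover have "r \<in> centralizer G v" using r rV[OF v] by (simp add: centralizer_def)
    ultimately have "r [^] i \<in> centralizer G v"
      by (metis subgroup_int_pow_closed)
    then show ?thesis by (simp add: centralizer_def)
  qed
  then have comm: "\<psi> p \<otimes> v = v \<otimes> \<psi> p" if "v \<in> V" for p v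
    using that r t VG tV by (auto simp: \<psi>_def split: prod.split) (metis int_pow_closed m_assoc)
  define \<phi> where "\<phi> = (\<lambda>(p, f). \<psi> p \<otimes> h f)"
  have \<phi>: "\<phi> \<in> hom (D8 \<times>\<times> C2_power k) G"
  proof (rule homI; clarsimp)
    fix i b f assume ib: "(i, b) \<in> carrier D8" and f: "f \<in> carrier (C2_power k)"
    then show "\<phi> ((i, b), f) \<in> carrier G" using \<psi>G hV VG by (simp add: \<phi>_def)
    fix j c g assume jc: "(j, c) \<in> carrier D8" and g: "g \<in> carrier (C2_power k)"
    note ij = ib jc and fg = f g
    show "\<phi> ((i, b) \<otimes>\<^bsub>D8\<^esub> (j, c), f \<otimes>\<^bsub>C2_power k\<^esub> g) = \<phi> ((i, b), f) \<otimes> \<phi> ((j, c), g)"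
    proof -
      let ?p = "\<psi> (i, b)" and ?q = "\<psi> (j, c)"
      have "\<psi> ((i, b) \<otimes>\<^bsub>D8\<^esub> (j, c)) = ?p \<otimes> ?q"
        using \<psi> ij by (intro hom_mult)
      moreover have "h (f \<otimes>\<^bsub>C2_power k\<^esub> g) = h f \<otimes> h g"
        using hom_mult[OF h] fg by simp
      moreover have "?p \<otimes> ?q \<otimes> (h f \<otimes> h g) = ?p \<otimes> (?q \<otimes> h f) \<otimes> h g"
        using \<psi>G VG hV fg by (simp add: m_assoc)
      moreover have "?p \<otimes> (h f \<otimes> ?q) \<otimes> h g = ?p \<otimes> h f \<otimes> (?q \<otimes> h g)"
        using \<psi>G VG hV fg by (simp add: m_assoc)
      ultimately show ?thesis
        using comm hV fg by (simp add: \<phi>_def)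
    qed
  qed
  have "p = \<one>\<^bsub>D8\<^esub> \<and> f = \<one>\<^bsub>C2_power k\<^esub>"
    if "p \<in> carrier D8" "f \<in> carrier (C2_power k)" "\<phi> (p, f) = \<one>" for p f
  proof -
    obtain i b where p: "p = (i, b)" by force
    have pow: "r [^] (2::int) = r \<otimes> r" "r [^] (3::int) = r \<otimes> r \<otimes> r"
      using r int_pow_int[of G r 2] int_pow_int[of G r 3] by (simp_all add: numeral_eq_Suc)
    note hfV = hV[OF that(2)]
    have hG: "h f \<in> carrier G" using hfV by (rule VG)
    have pf: "\<psi> p \<otimes> h f = \<one>" using that(3) by (simp add: \<phi>_def)
    \<comment> \<open>As \<open>h f\<close> is its own inverse, the dihedral component equals \<open>h f\<close> and therefore lies in \<open>V\<close>.\<close>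
    have "\<psi> p = \<psi> p \<otimes> (h f \<otimes> h f)" using sq[OF hfV] \<psi>G by simp
    also have "\<dots> = \<psi> p \<otimes> h f \<otimes> h f" using \<psi>G hG by (simp add: m_assoc)
    also have "\<dots> = h f" using pf hG by simp
    finally have ph: "\<psi> p = h f" .
    have cancel: "r \<otimes> r \<otimes> y \<notin> V" if "y \<in> carrier G" "y \<notin> V" for y
    proof
      assume "r \<otimes> r \<otimes> y \<in> V"
      then have "r \<otimes> r \<otimes> (r \<otimes> r \<otimes> y) \<in> V" using rr(1) V subgroup.m_closed by metis
      moreover have "r \<otimes> r \<otimes> (r \<otimes> r \<otimes> y) = (r \<otimes> r) \<otimes> (r \<otimes> r) \<otimes> y"
        using r that by (simp only: m_assoc m_closed)
      ultimately show False using that sq[OF rr(1)] by simp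
    qed
    have "i \<in> {0..<4}"
      using that(1) by (simp add: p dihedral_group_def carrier_integer_mod_group)
    then consider "i = int 0" | "i = int 1" | "i = int 2" | "i = int 3" by fastforce
    then have "\<psi> p \<in> {\<one>, r \<otimes> r} \<and> (\<psi> p = \<one> \<longrightarrow> p = (0, False))"
    proof cases
      case 1
      then show ?thesis using ph hfV notV(2) t by (auto simp: p \<psi>_def split: if_splits)
    next
      case 2
      then show ?thesis using ph hfV notV(1,3) r t
        by (auto simp: p \<psi>_def split: if_splits)
    next
      case 3
      then have "\<psi> p = r \<otimes> r \<otimes> (if b then t else \<one>)"
        using r by (simp add: p \<psi>_def pow)
      then show ?thesis using ph hfV cancel[OF t notV(2)] r rr by (auto split: if_splits)
    next
      case 4
      then have "\<psi> p = r \<otimes> r \<otimes> (r \<otimes> (if b then t else \<one>))"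
        using r t by (simp add: p \<psi>_def pow m_assoc)
      then show ?thesis using ph hfV cancel[of r] cancel[of "r \<otimes> t"] notV r t by (auto split: if_splits)
    qed
    moreover from this have f: "f = \<one>\<^bsub>C2_power k\<^esub>" using inj that(2) ph by simp
    then have "h f = \<one>"
      using hom_one[OF h group_C2_power V.is_group] by simp
    ultimately show ?thesis using f ph by (simp add: dihedral_group_def)
  qed
  then have inj_\<phi>: "inj_on \<phi> (carrier (D8 \<times>\<times> C2_power k))"
    using \<phi> DirProd_group[OF group_dihedral_group group_C2_power] is_group
    by (subst inj_on_one_iff') auto
  moreover have c: "card (carrier (D8 \<times>\<times> C2_power k)) = 8 * 2 ^ k"
    using order_dihedral_group[of 4] order_C2_power[of k]
    by (simp add: order_def card_cartesian_product)
  moreover have sub: "\<phi> ` carrier (D8 \<times>\<times> C2_power k) \<subseteq> carrier G"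
    using \<phi> by (auto simp: hom_def)
  ultimately have im: "card (\<phi> ` carrier (D8 \<times>\<times> C2_power k)) = 8 * 2 ^ k"
    using card_image by metis
  have "order G \<le> 8 * 2 ^ k" using index o rr(2) by simp
  then have surj: "\<phi> ` carrier (D8 \<times>\<times> C2_power k) = carrier G"
    using card_seteq[OF fin sub] im by (simp add: order_def)
  then have ord: "order G = 8 * 2 ^ k" using im by (simp add: order_def)
  have "\<phi> \<in> iso (D8 \<times>\<times> C2_power k) G"
    using \<phi> inj_\<phi> surj by (simp add: iso_def bij_betw_def)
  then have "G \<cong> D8 \<times>\<times> C2_power k"
    by (meson DirProd_group group.iso_sym group_C2_power group_dihedral_group is_isoI)
  then show ?thesis using ord by blast
qed

section \<open>Groups in which three quarters of the elements are involutions\<close>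

text \<open>
  If \<open>y\<close> lies in both \<open>I\<close> and \<open>x I\<close>, where \<open>I\<close> is the set of involutions, then \<open>y\<close> and \<open>x y\<close> are
  involutions and so \<open>y\<close> commutes with \<open>x\<close>. By inclusion and exclusion the overlap has at least
  \<open>2 \<cdot> 3|G|/4 - |G| = |G|/2\<close> elements.
\<close>

lemma (in group) card_commuting_involutions:
  assumes fin: "finite (carrier G)" and I: "4 * card (involutions G) = 3 * order G"
    and x: "x \<in> involutions G"
  shows "order G \<le> 2 * card (involutions G \<inter> centralizer G x)"
proof -
  let ?I = "involutions G"
  let ?J = "(\<lambda>y. x \<otimes> y) ` ?I"
  have xG: "x \<in> carrier G" and xx: "x \<otimes> x = \<one>" using x by (auto simp: mem_involutions_iff)
  have sub: "?I \<subseteq> carrier G" by (auto simp: involutions_def)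
  then have finI: "finite ?I" using fin finite_subset by blast
  have "card ?J = card ?I"
    using sub xG by (intro card_image inj_onI) (auto simp: subset_iff)
  moreover have "card (?I \<union> ?J) \<le> order G"
    unfolding order_def using sub xG fin by (intro card_mono) auto
  moreover have "card ?I + card ?J = card (?I \<union> ?J) + card (?I \<inter> ?J)"
    using finI by (intro card_Un_Int) auto
  moreover have "card (?I \<inter> ?J) \<le> card (?I \<inter> centralizer G x)"
  proof (intro card_mono subsetI)
    fix y assume y: "y \<in> ?I \<inter> ?J"
    then obtain w where w: "w \<in> ?I" "y = x \<otimes> w" by blast
    then have "x \<otimes> y = w"
      using xG xx sub by (auto simp: m_assoc[symmetric])
    then have "x \<otimes> y = y \<otimes> x"
      using x y w by (intro commute_if_involutions) auto
    then show "y \<in> ?I \<inter> centralizer G x" using y sub by (auto simp: centralizer_def)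
  qed (use finI in auto)
  ultimately show ?thesis using I by linarith
qed

text \<open>
  Central involutions form a subgroup, whereas no proper subgroup contains more than half of the group.
\<close>

lemma (in group) noncentral_involution_exists:
  assumes fin: "finite (carrier G)" and I: "4 * card (involutions G) = 3 * order G"
  shows "\<exists>x \<in> involutions G. centralizer G x \<noteq> carrier G"
proof (rule ccontr)
  assume "\<not> ?thesis"
  then have comm: "x \<otimes> y = y \<otimes> x" if "x \<in> involutions G" "y \<in> carrier G" for x y
    using that by (auto simp: centralizer_def)
  have pos: "order G > 0" using fin order_gt_0_iff_finite by simp
  have "subgroup (involutions G) G"
  proof (rule subgroupI)
    show "involutions G \<noteq> {}" using I pos by auto
    show "inv x \<in> involutions G" if "x \<in> involutions G" for x
      using that inv_equality[of x x] by (simp add: mem_involutions_iff)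
    show "x \<otimes> y \<in> involutions G" if "x \<in> involutions G" "y \<in> involutions G" for x y
      using that comm by (intro mult_involutions) (auto simp: mem_involutions_iff)
  qed (auto simp: involutions_def)
  then have "2 * card (involutions G) \<le> order G \<or> involutions G = carrier G"
    using order_le_twice_proper_subgroup[OF fin] by blast
  then show False using I pos by (auto simp: order_def)
qed

text \<open>
  The involutions in the centralizer number at least \<open>|G|/2\<close>, and the centralizer, as a proper
  subgroup, has at most \<open>|G|/2\<close> elements: the two coincide.
\<close>

lemma (in group) centralizer_noncentral_involution:
  assumes fin: "finite (carrier G)" and I: "4 * card (involutions G) = 3 * order G"
    and x: "x \<in> involutions G" and "centralizer G x \<noteq> carrier G"
  shows "2 * card (centralizer G x) = order G" and "centralizer G x \<subseteq> involutions G"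
proof -
  have sub: "subgroup (centralizer G x) G"
    using x by (simp add: subgroup_centralizer mem_involutions_iff)
  have finC: "finite (centralizer G x)" using fin by (simp add: centralizer_def)
  have 1: "2 * card (centralizer G x) \<le> order G"
    using order_le_twice_proper_subgroup[OF fin sub] assms by blast
  have 2: "order G \<le> 2 * card (involutions G \<inter> centralizer G x)"
    by (rule card_commuting_involutions[OF fin I x])
  have 3: "card (involutions G \<inter> centralizer G x) \<le> card (centralizer G x)"
    using finC by (intro card_mono) auto
  show "2 * card (centralizer G x) = order G" using 1 2 3 by linarith
  have "involutions G \<inter> centralizer G x = centralizer G x"
    using 1 2 finC by (intro card_seteq) auto
  then show "centralizer G x \<subseteq> involutions G" by blast
qed

text \<open>
  With \<open>A\<close> the centralizer of a noncentral involution \<open>x\<close>, an involution \<open>t\<close> outside of \<open>A\<close> does not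
  commute with \<open>x\<close>. The dihedral part is generated by \<open>r = x t\<close> and \<open>t\<close>, and the subgroup \<open>V\<close> in
  which the complement is taken consists of the elements of \<open>A\<close> commuting with \<open>t\<close>.
\<close>

lemma (in group) iso_if_three_quarters_involutions:
  assumes fin: "finite (carrier G)" and I: "4 * card (involutions G) = 3 * order G"
  shows "\<exists>k. order G = 8 * 2 ^ k \<and> G \<cong> D8 \<times>\<times> C2_power k"
proof -
  have pos: "order G > 0" using fin order_gt_0_iff_finite by simp
  obtain x where x: "x \<in> involutions G" "centralizer G x \<noteq> carrier G"
    using noncentral_involution_exists[OF fin I] by blast
  define A where "A = centralizer G x"
  have cA: "2 * card A = order G" and AI: "A \<subseteq> involutions G"
    using centralizer_noncentral_involution[OF fin I x] by (auto simp: A_def)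
  have xG: "x \<in> carrier G" and xx: "x \<otimes> x = \<one>" using x by (auto simp: mem_involutions_iff)
  have A: "subgroup A G" unfolding A_def using xG by (rule subgroup_centralizer)
  have xA: "x \<in> A" using xG by (simp add: A_def centralizer_def)
  have finA: "finite A" using fin by (simp add: A_def centralizer_def)
  have Acomm: "a \<otimes> b = b \<otimes> a" if "a \<in> A" "b \<in> A" for a b
    using that AI subgroup.m_closed[OF A] by (intro commute_if_involutions) auto
  have cIA: "card (involutions G - A) = card (involutions G) - card A"
    using finA AI by (rule card_Diff_subset)
  then have "card (involutions G - A) \<noteq> 0" using cA I pos by linarith
  then obtain t where t: "t \<in> involutions G" "t \<notin> A"
    by (metis DiffE card.empty all_not_in_conv)
  then have tG: "t \<in> carrier G" and tt: "t \<otimes> t = \<one>" by (auto simp: mem_involutions_iff)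
  define V where "V = A \<inter> centralizer G t"
  have V: "subgroup V G" unfolding V_def
    using A subgroup_centralizer[OF tG] by (rule subgroup_Int)
  \<comment> \<open>The index of \<open>V\<close> is at most 4, since \<open>V\<close> has at least as many elements as there are
    involutions outside of \<open>A\<close>, namely \<open>3|G|/4 - |G|/2\<close>.\<close>
  have "involutions G - A \<subseteq> (\<lambda>v. v \<otimes> t) ` V"
  proof
    fix y assume y: "y \<in> involutions G - A"
    then have yG: "y \<in> carrier G" by (simp add: mem_involutions_iff)
    have ytA: "y \<otimes> t \<in> A"
      using y t tG tt yG by (intro mult_mem_index_two_subgroup[OF fin A cA]) auto
    then have "y \<otimes> t = t \<otimes> y" using y t AI by (intro commute_if_involutions) auto
    then have "y \<otimes> t \<in> V"
      using ytA yG tG by (auto simp: V_def centralizer_def m_assoc)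
    moreover have "y = y \<otimes> t \<otimes> t" using yG tG tt by (simp add: m_assoc)
    ultimately show "y \<in> (\<lambda>v. v \<otimes> t) ` V" by blast
  qed
  moreover have finV: "finite V" using finA by (simp add: V_def)
  ultimately have "card (involutions G - A) \<le> card V" by (rule surj_card_le[rotated])
  then have le: "order G \<le> 4 * card V" using cIA cA I by linarith
  have xt: "t \<otimes> x \<noteq> x \<otimes> t" using t tG by (auto simp: A_def centralizer_def)
  let ?r = "x \<otimes> t"
  have VA: "\<And>v. v \<in> V \<Longrightarrow> v \<in> A" and tV: "\<And>v. v \<in> V \<Longrightarrow> t \<otimes> v = v \<otimes> t"
    by (auto simp: V_def centralizer_def)
  have AG: "\<And>v. v \<in> A \<Longrightarrow> v \<in> carrier G" by (simp add: A_def centralizer_def)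
  have xV: "x \<notin> V" using xt by (auto dest: tV)
  have rA: "?r \<notin> A"
  proof
    assume "?r \<in> A"
    then have "x \<otimes> ?r \<in> A" using xA A subgroup.m_closed by metis
    then show False using t xG tG xx by (simp add: m_assoc[symmetric])
  qed
  have inv_r: "inv ?r = t \<otimes> x"
    using xG tG xx tt by (simp add: inv_mult_group inv_equality)
  \<comment> \<open>\<open>A\<close> is normal, having index 2, so it contains the conjugate \<open>t x t\<close>. As \<open>A\<close> is abelian,
    \<open>x\<close> commutes with \<open>t x t\<close>; this makes \<open>r\<^sup>2 = x (t x t)\<close> commute with \<open>t\<close>.\<close>
  have txA: "t \<otimes> x \<notin> A"
  proof
    assume "t \<otimes> x \<in> A"
    then have "inv (t \<otimes> x) \<in> A" using A subgroup.m_inv_closed by metis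
    then show False using rA xG tG inv_r by (metis inv_inv m_closed)
  qed
  have txtA: "t \<otimes> x \<otimes> t \<in> A"
    using rA t tG tt xG mult_mem_index_two_subgroup[OF fin A cA, of t "t \<otimes> x"] txA by auto
  show ?thesis
  proof (rule iso_D8_C2_power[OF fin V le _ _ tG tt])
    show "v \<otimes> v = \<one>" if "v \<in> V" for v
      using VA[OF that] AI by (auto simp: mem_involutions_iff)
    show "?r \<in> carrier G" using xG tG by simp
    show "t \<otimes> ?r \<otimes> t = inv ?r"
      unfolding inv_r using xG tG tt by (simp add: m_assoc)
    have "?r \<otimes> ?r \<in> A"
      using subgroup.m_closed[OF A xA txtA] xG tG by (simp add: m_assoc)
    moreover have "t \<otimes> (?r \<otimes> ?r) = ?r \<otimes> ?r \<otimes> t"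
    proof -
      have "t \<otimes> (?r \<otimes> ?r) = t \<otimes> x \<otimes> t \<otimes> x \<otimes> t"
        using xG tG by (simp add: m_assoc)
      also have "\<dots> = x \<otimes> (t \<otimes> x \<otimes> t) \<otimes> t" using Acomm[OF txtA xA] by simp
      also have "\<dots> = ?r \<otimes> ?r \<otimes> t" using xG tG by (simp add: m_assoc)
      finally show ?thesis .
    qed
    ultimately show "?r \<otimes> ?r \<in> V"
      using xG tG by (simp add: V_def centralizer_def)
    show "?r \<otimes> ?r \<noteq> \<one>"
      using xt inv_equality[of ?r ?r] xG tG unfolding inv_r by auto
    show "?r \<notin> V" using rA VA by blast
    show "t \<notin> V" using t VA by blast
    show "?r \<otimes> t \<notin> V" using xV xG tG tt by (simp add: m_assoc)
    show "t \<otimes> v = v \<otimes> t" if "v \<in> V" for v using that by (rule tV)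
    show "?r \<otimes> v = v \<otimes> ?r" if "v \<in> V" for v
      using that Acomm[OF xA VA[OF that]] tV[OF that] AG[OF VA[OF that]] xG tG
      by (metis m_assoc)
  qed
qed

theorem theorem5p2:
  fixes G :: "('a, 'b) monoid_scheme"
  assumes "group G"
    and "finite (carrier G)"
    and "involution_ratio G = 3 / 4"
  shows "\<exists>n::nat. n \<ge> 3 \<and> order G = 2 ^ n \<and> G \<cong> D8 \<times>\<times> C2_power (n - 3)"
proof -
  interpret group G by fact
  note fin = assms(2)
  have pos: "order G > 0" using fin order_gt_0_iff_finite by simp
  have "4 * real (card (involutions G)) = 3 * real (order G)"
    using assms(3) pos by (simp add: involution_ratio_def num_involutions_def field_simps)
  then have I: "4 * card (involutions G) = 3 * order G" by linarith
  from iso_if_three_quarters_involutions[OF fin I]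
  obtain k where "order G = 8 * 2 ^ k" "G \<cong> D8 \<times>\<times> C2_power k" by blast
  then show ?thesis by (intro exI[of _ "k + 3"]) (simp add: power_add)
qed

end
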